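(* Let $n\equiv 2 \pmod 4$ be a nonnegative integer. Then $$v_e^o(n,0)=v_e^o(n,2).$$ In particular, conjugation $\lambda\mapsto\lambda^t$ restricts to a bijection $V_e^o(n,0)\to V_e^o(n,2)$.
   Context: A partition of $n$ is a weakly decreasing sequence of positive integers (parts) with sum $n$. The conjugate $\lambda^t$ of a partition $\lambda$ is the partition whose Young diagram is the reflection of that of $\lambda$ in the main diagonal. $P_e^o(n)$ is the set of partitions of $n$ in which every even part is smaller than every odd part (this includes the cases where all parts are even or all parts are odd). $V_e^o(n)$ is the set of all $\lambda\in P_e^o(n)$ such that: (V1) every part size that is odd occurs with even multiplicity; and (V2) if even parts exist, then the largest even part has odd multiplicity and all other even part sizes have even multiplicity. Let $L(\lambda)$ be the largest even part of $\lambda$, with $L(\lambda)=0$ if $\lambda$ has no even parts. For an integer $m$ define $V_e^o(n,m)=\{\lambda\in V_e^o(n) : L(\lambda)\equiv m \pmod 4\}$ and $v_e^o(n,m)=\#V_e^o(n,m)$. *)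

theory Defs
  imports Main "HOL-Number_Theory.Cong"
begin

text \<open>A partition is represented by the list of its parts in weakly decreasing order.\<close>

definition is_partition :: "nat list \<Rightarrow> bool" where
  "is_partition l \<longleftrightarrow> sorted_wrt (\<ge>) l \<and> (\<forall>p\<in>set l. 0 < p)"

definition partitions :: "nat \<Rightarrow> nat list set" where
  "partitions n = {l. is_partition l \<and> sum_list l = n}"

text \<open>Cells are (row, column) pairs, both counted from 0; reflection in the main diagonal is
  the converse relation.\<close>

definition young_diagram :: "nat list \<Rightarrow> (nat \<times> nat) set" where
  "young_diagram l = {(i, j). i < length l \<and> j < l ! i}"

definition conjugate :: "nat list \<Rightarrow> nat list" where
  "conjugate l = (THE m. is_partition m \<and> young_diagram m = (young_diagram l)\<inverse>)"

definition P_eo :: "nat \<Rightarrow> nat list set" where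
  "P_eo n = {l \<in> partitions n. \<forall>p\<in>set l. \<forall>q\<in>set l. even p \<and> odd q \<longrightarrow> p < q}"

definition L :: "nat list \<Rightarrow> nat" where
  "L l = (if \<exists>p\<in>set l. even p then Max {p \<in> set l. even p} else 0)"

definition V_eo :: "nat \<Rightarrow> nat list set" where
  "V_eo n = {l \<in> P_eo n.
     (\<forall>p\<in>set l. odd p \<longrightarrow> even (count_list l p)) \<and>
     ((\<exists>p\<in>set l. even p) \<longrightarrow>
        odd (count_list l (L l)) \<and>
        (\<forall>p\<in>set l. even p \<and> p \<noteq> L l \<longrightarrow> even (count_list l p)))}"

definition V_eo_mod :: "nat \<Rightarrow> int \<Rightarrow> nat list set" where
  "V_eo_mod n m = {l \<in> V_eo n. [int (L l) = m] (mod 4)}"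

definition v_eo :: "nat \<Rightarrow> int \<Rightarrow> nat" where
  "v_eo n m = card (V_eo_mod n m)"

text \<open>The definite description in \<^const>\<open>conjugate\<close> is well defined, and \<^const>\<open>card\<close> in
  \<^const>\<open>v_eo\<close> is applied to finite sets only.\<close>

lemma is_partition_nth_mono:
  assumes "is_partition l" "i \<le> k" "k < length l"
  shows "l ! k \<le> l ! i"
  using assms by (cases "i = k") (auto simp: is_partition_def sorted_wrt_iff_nth_less)

lemma young_diagram_inj:
  assumes l: "is_partition l" and m: "is_partition m"
    and eq: "young_diagram l = young_diagram m"
  shows "l = m"
proof (rule nth_equalityI)
  have col: "(i, 0) \<in> young_diagram x \<longleftrightarrow> i < length x" if "is_partition x" for x i
    using that by (auto simp: is_partition_def young_diagram_def)
  have iff: "i < length l \<longleftrightarrow> i < length m" for i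
    using col[OF l] col[OF m] eq by simp
  then show len: "length l = length m"
    by (meson linorder_neqE_nat less_irrefl)
  fix i assume i: "i < length l"
  have "j < l ! i \<longleftrightarrow> j < m ! i" for j
    using eq i len by (auto simp: young_diagram_def set_eq_iff)
  then show "l ! i = m ! i"
    by (meson linorder_neqE_nat less_irrefl)
qed

lemma conjugate_exists:
  assumes l: "is_partition l"
  shows "\<exists>m. is_partition m \<and> young_diagram m = (young_diagram l)\<inverse>"
proof -
  define r where "r j = card {i. i < length l \<and> j < l ! i}" for j
  define c where "c = (if l = [] then 0 else l ! 0)"
  define m where "m = map r [0..<c]"
  have r_iff: "i < r j \<longleftrightarrow> i < length l \<and> j < l ! i" for i j
  proof -
    let ?S = "{i. i < length l \<and> j < l ! i}"
    have fin: "finite ?S" by simp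
    have down: "i' \<in> ?S" if "i \<in> ?S" "i' \<le> i" for i i'
      using that is_partition_nth_mono[OF l, of i' i] by auto
    show ?thesis
    proof
      assume "i < r j"
      show "i < length l \<and> j < l ! i"
      proof (rule ccontr)
        assume "\<not> ?thesis"
        then have "i \<notin> ?S" by simp
        then have "?S \<subseteq> {..<i}" using down by (meson lessThan_iff not_le subsetI)
        then have "card ?S \<le> i" using card_mono[of "{..<i}" ?S] by simp
        with \<open>i < r j\<close> show False by (simp add: r_def)
      qed
    next
      assume "i < length l \<and> j < l ! i"
      then have "i \<in> ?S" by simp
      then have "{..i} \<subseteq> ?S" using down by (meson atMost_iff subsetI)
      then have "card {..i} \<le> card ?S" using fin card_mono by blast
      then show "i < r j" by (simp add: r_def)
    qed
  qed
  have c_bound: "j < c" if "i < length l" "j < l ! i" for i j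
    using that is_partition_nth_mono[OF l, of 0 i] by (auto simp: c_def)
  have "r b \<le> r a" if "a \<le> b" for a b
    unfolding r_def by (rule card_mono) (use that in auto)
  then have dec: "sorted_wrt (\<ge>) m"
    by (auto simp: m_def sorted_wrt_iff_nth_less)
  have "0 < r j" if "j < c" for j
    using that r_iff[of 0 j] by (auto simp: c_def split: if_splits)
  then have "is_partition m"
    using dec by (auto simp: is_partition_def m_def)
  moreover have "young_diagram m = (young_diagram l)\<inverse>"
    using c_bound by (auto simp: young_diagram_def m_def r_iff)
  ultimately show ?thesis by blast
qed

lemma conjugate_unique_exists:
  assumes "is_partition l"
  shows "\<exists>!m. is_partition m \<and> young_diagram m = (young_diagram l)\<inverse>"
  using conjugate_exists[OF assms] young_diagram_inj by metis

lemma finite_partitions: "finite (partitions n)"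
proof (rule finite_subset)
  show "partitions n \<subseteq> {l. set l \<subseteq> {..n} \<and> length l \<le> n}"
  proof
    fix l assume "l \<in> partitions n"
    then have s: "sum_list l = n" and p: "\<forall>p\<in>set l. 0 < p"
      by (auto simp: partitions_def is_partition_def)
    have "length l \<le> sum_list l" using p by (induction l) auto
    then show "l \<in> {l. set l \<subseteq> {..n} \<and> length l \<le> n}"
      using s member_le_sum_list by fastforce
  qed
  show "finite {l. set l \<subseteq> {..n} \<and> length l \<le> n}"
    by (rule finite_lists_length_le) simp
qed

lemma finite_V_eo_mod: "finite (V_eo_mod n m)"
  by (rule finite_subset[OF _ finite_partitions[of n]])
    (auto simp: V_eo_mod_def V_eo_def P_eo_def)

end

theory Submission
  imports Defs
begin

text \<open>
  For every \<open>n\<close>, conjugation maps \<open>V_eo n\<close> to itself and satisfies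
  \<open>L l + L (conjugate l) \<equiv> n\<close> modulo 4 (lemma \<open>V_eo_conjugate\<close>). Being an involution, it is
  therefore a bijection from the class of \<open>L \<equiv> m\<close> to that of \<open>L \<equiv> n - m\<close>. The theorem is the case
  \<open>n \<equiv> 2\<close>, \<open>m = 0\<close>.

  Passing from column \<open>v - 1\<close> to column \<open>v\<close> of the Young diagram, the column length drops by the
  multiplicity of the part \<open>v\<close>. So the conditions on multiplicities say that the parity of the
  column lengths changes at most once, namely at column \<open>a = L l\<close>: the columns before it have odd
  length, the remaining ones even length. The conditions on which parts may occur say that the
  columns left of \<open>a\<close> are equal in pairs, \<open>(0, 1), (2, 3), \<dots>\<close>, and that those right of \<open>a\<close> are
  equal in pairs, \<open>(a + 1, a + 2), (a + 3, a + 4), \<dots>\<close>. This description, \<open>block_profile\<close> below,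
  characterises membership (lemmas \<open>V_eo_imp_block_profile\<close> and \<open>block_profile_imp_V_eo\<close>).

  Let \<open>b\<close> be the length of column \<open>a\<close>, an even number. The diagram then consists of the rectangle
  of \<open>b\<close> rows and \<open>a\<close> columns, the first \<open>b\<close> cells of column \<open>a\<close>, the first \<open>a\<close> cells of row \<open>b\<close>,
  and two regions, to the right of and below these, that are tiled by aligned \<open>2 \<times> 2\<close> blocks.
  This shape is visibly symmetric under reflection, which exchanges \<open>a\<close> and \<open>b\<close>
  (lemma \<open>block_profile_transpose\<close>), so \<open>L (conjugate l) = b\<close>. Counting cells modulo 4, the
  rectangle and the blocks vanish and \<open>n \<equiv> a + b\<close> remains (lemma \<open>sum_block_profile\<close>).
\<close>

section \<open>Row and column lengths of a Young diagram\<close>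

definition row_len :: "nat list \<Rightarrow> nat \<Rightarrow> nat" where
  "row_len l i = (if i < length l then l ! i else 0)"

definition col_len :: "nat list \<Rightarrow> nat \<Rightarrow> nat" where
  "col_len l j = length (filter (\<lambda>x. j < x) l)"

lemma mem_young_diagram_row: "(i, j) \<in> young_diagram l \<longleftrightarrow> j < row_len l i"
  by (auto simp: young_diagram_def row_len_def)

lemma less_length_filter_iff_sorted:
  assumes "sorted_wrt (\<ge>) (l :: nat list)"
  shows "i < length (filter (\<lambda>x. j < x) l) \<longleftrightarrow> i < length l \<and> j < l ! i"
  using assms
proof (induction l arbitrary: i)
  case Nil
  then show ?case by simp
next
  case (Cons x l)
  show ?case
  proof (cases "j < x")
    case True
    then show ?thesis using Cons by (cases i) auto
  next
    case False
    then have small: "y \<le> j" if "y \<in> set (x # l)" for y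
      using that Cons.prems by fastforce
    then have "filter (\<lambda>x. j < x) (x # l) = []"
      by (meson filter_False leD)
    moreover have "\<not> j < (x # l) ! i" if "i < length (x # l)"
      using small nth_mem[OF that] by (meson leD)
    ultimately show ?thesis by auto
  qed
qed

lemma mem_young_diagram_col:
  assumes "is_partition l"
  shows "(i, j) \<in> young_diagram l \<longleftrightarrow> i < col_len l j"
  using assms
  by (simp add: col_len_def young_diagram_def is_partition_def less_length_filter_iff_sorted)

lemma less_col_len_iff_less_row_len:
  assumes "is_partition l"
  shows "i < col_len l j \<longleftrightarrow> j < row_len l i"
  using mem_young_diagram_col[OF assms] mem_young_diagram_row by blast

lemma col_len_eq_count_list_plus: "col_len l j = count_list l (Suc j) + col_len l (Suc j)"
  unfolding col_len_def by (induction l) auto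

lemma col_len_eventually_zero: "\<exists>N. \<forall>j\<ge>N. col_len l j = 0"
proof (intro exI allI impI)
  fix j assume "sum_list l \<le> j"
  then have "\<not> j < x" if "x \<in> set l" for x
    using member_le_sum_list[OF that] by simp
  then show "col_len l j = 0" by (simp add: col_len_def)
qed

lemma card_young_diagram: "card (young_diagram l) = sum_list l"
proof -
  have "young_diagram l = (SIGMA i:{..<length l}. {..<l ! i})"
    by (auto simp: young_diagram_def)
  then show ?thesis
    by (simp add: sum_list_sum_nth atLeast0LessThan)
qed

section \<open>Conjugation\<close>

lemma
  assumes "is_partition l"
  shows is_partition_conjugate: "is_partition (conjugate l)"
    and young_diagram_conjugate: "young_diagram (conjugate l) = (young_diagram l)\<inverse>"
  using theI'[OF conjugate_unique_exists[OF assms]] unfolding conjugate_def by auto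

lemma conjugate_conjugate:
  assumes "is_partition l"
  shows "conjugate (conjugate l) = l"
  using assms by (intro young_diagram_inj) (simp_all add: is_partition_conjugate young_diagram_conjugate)

lemma sum_list_conjugate:
  assumes "is_partition l"
  shows "sum_list (conjugate l) = sum_list l"
  using assms by (simp add: young_diagram_conjugate flip: card_young_diagram)

lemma col_len_conjugate:
  assumes "is_partition l"
  shows "col_len (conjugate l) = row_len l"
proof
  fix j
  have "i < col_len (conjugate l) j \<longleftrightarrow> i < row_len l j" for i
    using assms
    by (simp add: is_partition_conjugate young_diagram_conjugate
        flip: mem_young_diagram_col mem_young_diagram_row)
  then show "col_len (conjugate l) j = row_len l j"
    by (meson linorder_neqE_nat less_irrefl)
qed

section \<open>Profiles made of two-by-two blocks\<close>

text \<open>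
  Here \<open>f\<close> lists the column lengths (or, symmetrically, the row lengths) of a diagram, and \<open>a\<close> is
  the unique unpaired column. For \<open>a = 0\<close> there are no odd columns.
\<close>

definition block_profile :: "(nat \<Rightarrow> nat) \<Rightarrow> nat \<Rightarrow> bool" where
  "block_profile f a \<longleftrightarrow> even a \<and> (\<forall>j. odd (f j) \<longleftrightarrow> j < a) \<and>
     (\<forall>j<a. even j \<longrightarrow> f j = f (Suc j)) \<and> (\<forall>j\<ge>a. odd j \<longrightarrow> f j = f (Suc j))"

text \<open>
  The hypothesis \<open>gal\<close> says that \<open>f\<close> and \<open>g\<close> are the column and row lengths of one diagram.
  Parity of one profile and pairing of the other are then two views of the same fact: a row
  can only end between two columns of different length, so the pairs of equal columns fix the parity
  of the row lengths; and consecutive rows \<open>i\<close> and \<open>i + 1\<close> differ only if some column has length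
  \<open>i + 1\<close>, which the parity of the column lengths excludes for every other \<open>i\<close>.
\<close>

lemma block_profile_transpose:
  fixes f g :: "nat \<Rightarrow> nat"
  assumes f: "block_profile f a"
    and gal: "\<And>i j. i < f j \<longleftrightarrow> j < g i"
  shows "block_profile g (f a)" and "g (f a) = a"
proof -
  have a: "even a" and par: "odd (f j) \<longleftrightarrow> j < a"
    and left: "j < a \<Longrightarrow> even j \<Longrightarrow> f j = f (Suc j)"
    and right: "a \<le> j \<Longrightarrow> odd j \<Longrightarrow> f j = f (Suc j)" for j
    using f by (auto simp: block_profile_def)
  have b: "even (f a)" using par by blast
  have anti: "f k \<le> f j" if "j \<le> k" for j k
  proof (rule ccontr)
    assume "\<not> f k \<le> f j"
    then have "k < g (f j)" using gal[of "f j" k] by simp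
    then have "f j < f j" using gal[of "f j" j] that by simp
    then show False by simp
  qed
  have before: "f a < f j" if "j < a" for j
    using anti[of j a] par[of j] that b by (cases "f j = f a") auto
  show gb: "g (f a) = a"
  proof -
    have "j < g (f a) \<longleftrightarrow> j < a" for j
      using gal[of "f a" j] before[of j] anti[of a j] by (cases "j < a") auto
    then show ?thesis by (meson linorder_neqE_nat less_irrefl)
  qed
  have g_step: "f (g i) \<le> i" "0 < g i \<Longrightarrow> i < f (g i - 1)" for i
    using gal[of i "g i"] gal[of i "g i - 1"] by auto
  have upper: "a < g i" if "i < f a" for i
    using that gal by blast
  have lower: "g i \<le> a" if "f a \<le> i" for i
    using that gal[of i a] by simp
  have parity: "odd (g i) \<longleftrightarrow> i < f a" for i
  proof
    assume o: "odd (g i)"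
    show "i < f a"
    proof (rule ccontr)
      assume "\<not> i < f a"
      then have "g i < a" using lower[of i] o a by (cases "g i = a") auto
      then have "f (g i - 1) = f (g i)"
        using left[of "g i - 1"] o by (simp add: odd_pos)
      then show False using g_step[of i] o by (simp add: odd_pos)
    qed
  next
    assume i: "i < f a"
    show "odd (g i)"
    proof
      assume e: "even (g i)"
      have "a < g i" using upper[OF i] .
      then have "f (g i - 1) = f (g i)"
        using right[of "g i - 1"] e by simp
      then show False using g_step[of i] \<open>a < g i\<close> by simp
    qed
  qed
  have eqI: "g i = g (Suc i)" if "\<And>j. f j \<noteq> Suc i" for i
  proof -
    have "j < g i \<longleftrightarrow> j < g (Suc i)" for j
      using gal[of i j] gal[of "Suc i" j] that[of j] by auto
    then show ?thesis by (meson linorder_neqE_nat less_irrefl)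
  qed
  have "g i = g (Suc i)" if "i < f a" "even i" for i
  proof (rule eqI)
    fix j
    show "f j \<noteq> Suc i"
      using that par[of j] before[of j] by (cases "j < a") auto
  qed
  moreover have "g i = g (Suc i)" if "f a \<le> i" "odd i" for i
  proof (rule eqI)
    fix j
    show "f j \<noteq> Suc i"
      using that par[of j] anti[of a j] by (cases "j < a") auto
  qed
  ultimately show "block_profile g (f a)"
    using b parity by (simp add: block_profile_def)
qed

text \<open>
  Two equal odd entries contribute 2 modulo 4, two equal even entries contribute 0. The bound
  \<open>a + 2 * k + 1\<close> stops after a complete pair.
\<close>

lemma sum_block_profile:
  assumes "block_profile f a"
  shows "[(\<Sum>i<a + 2 * k + 1. f i) = a + f a] (mod 4)"
proof -
  have a: "even a" and par: "odd (f j) \<longleftrightarrow> j < a"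
    and left: "j < a \<Longrightarrow> even j \<Longrightarrow> f j = f (Suc j)"
    and right: "a \<le> j \<Longrightarrow> odd j \<Longrightarrow> f j = f (Suc j)" for j
    using assms by (auto simp: block_profile_def)
  have init: "[(\<Sum>i<2 * h. f i) = 2 * h] (mod 4)" if "2 * h \<le> a" for h
    using that
  proof (induction h)
    case 0
    then show ?case by simp
  next
    case (Suc h)
    have "f (2 * h) = f (Suc (2 * h))" using left Suc.prems by simp
    moreover have "odd (f (2 * h))" using par Suc.prems by simp
    then obtain c where "f (2 * h) = 2 * c + 1" by (elim oddE)
    ultimately have "f (2 * h) + f (Suc (2 * h)) = 2 + 4 * c" by simp
    then have "[f (2 * h) + f (Suc (2 * h)) = 2] (mod 4)"
      unfolding cong_def by presburger
    moreover have "[(\<Sum>i<2 * h. f i) = 2 * h] (mod 4)" using Suc by simp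
    ultimately have "[(\<Sum>i<2 * h. f i) + (f (2 * h) + f (Suc (2 * h))) = 2 * h + 2] (mod 4)"
      by (intro cong_add)
    then show ?case by (simp add: add.assoc)
  qed
  show ?thesis
  proof (induction k)
    case 0
    show ?case using init[of "a div 2"] a by (simp add: cong_add)
  next
    case (Suc k)
    have "f (a + 2 * k + 1) = f (Suc (a + 2 * k + 1))" using right a by simp
    moreover have "even (f (a + 2 * k + 1))" using par[of "a + 2 * k + 1"] by simp
    then obtain c where "f (a + 2 * k + 1) = 2 * c" by (elim evenE)
    ultimately have "f (a + 2 * k + 1) + f (Suc (a + 2 * k + 1)) = 4 * c" by simp
    then have "[f (a + 2 * k + 1) + f (Suc (a + 2 * k + 1)) = 0] (mod 4)"
      by (simp add: cong_def)
    from cong_add[OF Suc this] show ?case by (simp add: add.assoc)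
  qed
qed

section \<open>Membership in terms of column lengths\<close>

lemma L_eqI:
  assumes "0 < a" "even a" "a \<in> set l" and "\<And>v. v \<in> set l \<Longrightarrow> even v \<Longrightarrow> v \<le> a"
  shows "L l = a"
proof -
  have "Max {p \<in> set l. even p} = a"
    using assms by (intro Max_eqI) auto
  then show ?thesis using assms by (auto simp: L_def)
qed

text \<open>
  A part \<open>v\<close> occurs iff columns \<open>v - 1\<close> and \<open>v\<close> differ, and has odd multiplicity iff their lengths
  differ in parity. The odd parts exceed \<open>L l\<close> and the even parts do not, so the sizes that cannot
  occur are the odd ones below \<open>L l\<close> and the even ones above; they yield the equal pairs of columns.
\<close>

lemma V_eo_imp_block_profile:
  assumes "l \<in> V_eo n"
  shows "block_profile (col_len l) (L l)"
proof -
  let ?a = "L l"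
  have sep: "\<And>p q. p \<in> set l \<Longrightarrow> q \<in> set l \<Longrightarrow> even p \<Longrightarrow> odd q \<Longrightarrow> p < q"
    and mult_odd: "\<And>p. p \<in> set l \<Longrightarrow> odd p \<Longrightarrow> even (count_list l p)"
    and mult_even: "(\<exists>p\<in>set l. even p) \<Longrightarrow> odd (count_list l ?a) \<and>
        (\<forall>p\<in>set l. even p \<and> p \<noteq> ?a \<longrightarrow> even (count_list l p))"
    using assms unfolding V_eo_def P_eo_def partitions_def by blast+
  have L_Max: "?a = Max {p \<in> set l. even p}" if "p \<in> set l" "even p" for p
    using that by (auto simp: L_def)
  have L_ge: "p \<le> ?a" if "p \<in> set l" "even p" for p
    using that L_Max[OF that] by simp
  have L_mem: "?a \<in> set l" "even ?a" if "p \<in> set l" "even p" for p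
    using that Max_in[of "{p \<in> set l. even p}"] L_Max[OF that] by auto
  have L_pos: "\<exists>p\<in>set l. even p" if "0 < ?a"
    using that by (auto simp: L_def split: if_splits)
  have even_L: "even ?a" using L_mem L_pos by (cases "?a = 0") auto
  have L_less: "?a < q" if "q \<in> set l" "odd q" for q
  proof (cases "?a = 0")
    case True
    then show ?thesis using that by (simp add: odd_pos)
  next
    case False
    then obtain p where p: "p \<in> set l" "even p" using L_pos by auto
    show ?thesis using sep[OF L_mem(1)[OF p] that(1) L_mem(2)[OF p] that(2)] .
  qed
  have flip: "odd (count_list l v) \<longleftrightarrow> v = ?a" if "0 < v" for v
  proof (cases "v \<in> set l")
    case True
    then show ?thesis
      using mult_odd mult_even even_L by (cases "even v") auto
  next
    case False
    then show ?thesis using L_pos L_mem that by auto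
  qed
  have parity: "odd (col_len l j) \<longleftrightarrow> j < ?a" for j
  proof -
    obtain N where N: "\<And>j. N \<le> j \<Longrightarrow> col_len l j = 0"
      using col_len_eventually_zero by blast
    \<comment> \<open>Downward induction from a column beyond both the diagram and \<open>L l\<close>.\<close>
    have "j \<le> max N (max j ?a)" by simp
    then show ?thesis
    proof (induction rule: inc_induct)
      case base
      then show ?case using N by simp
    next
      case (step k)
      have "odd (col_len l k) \<longleftrightarrow> (Suc k = ?a) \<noteq> (Suc k < ?a)"
        using step.IH flip[of "Suc k"] col_len_eq_count_list_plus[of l k] by auto
      then show ?case by auto
    qed
  qed
  have eqI: "col_len l j = col_len l (Suc j)" if "Suc j \<notin> set l" for j
    using that col_len_eq_count_list_plus[of l j] by (simp add: count_list_0_iff)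
  have "Suc j \<notin> set l" if "j < ?a" "even j" for j
    using L_less[of "Suc j"] that by auto
  moreover have "Suc j \<notin> set l" if "?a \<le> j" "odd j" for j
    using L_ge[of "Suc j"] that by auto
  ultimately show ?thesis
    unfolding block_profile_def using even_L parity eqI by blast
qed

lemma block_profile_imp_V_eo:
  assumes part: "l \<in> partitions n" and prof: "block_profile (col_len l) a"
  shows "l \<in> V_eo n" and "L l = a"
proof -
  have a: "even a" and par: "odd (col_len l j) \<longleftrightarrow> j < a"
    and left: "j < a \<Longrightarrow> even j \<Longrightarrow> col_len l j = col_len l (Suc j)"
    and right: "a \<le> j \<Longrightarrow> odd j \<Longrightarrow> col_len l j = col_len l (Suc j)" for j
    using prof by (auto simp: block_profile_def)
  have pos: "0 < v" if "v \<in> set l" for v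
    using that part by (auto simp: partitions_def is_partition_def)
  have drop: "col_len l (v - 1) = count_list l v + col_len l v" if "0 < v" for v
    using that col_len_eq_count_list_plus[of l "v - 1"] by simp
  have strict: "col_len l (v - 1) \<noteq> col_len l v" if "v \<in> set l" for v
    using drop[OF pos[OF that]] that by (simp add: count_list_0_iff)
  have odd_part: "a < v" if "v \<in> set l" "odd v" for v
    using strict[OF that(1)] left[of "v - 1"] that pos[OF that(1)] by fastforce
  have even_part: "v \<le> a" if "v \<in> set l" "even v" for v
    using strict[OF that(1)] right[of "v - 1"] that pos[OF that(1)] by fastforce
  have flip: "odd (count_list l v) \<longleftrightarrow> v = a" if "0 < v" for v
  proof -
    have "odd (count_list l v) \<longleftrightarrow> (v - 1 < a) \<noteq> (v < a)"
      using drop[OF that] par[of v] par[of "v - 1"] by auto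
    then show ?thesis using that by auto
  qed
  show La: "L l = a"
  proof (cases "a = 0")
    case True
    then have "\<not> (\<exists>p\<in>set l. even p)" using even_part pos by fastforce
    then show ?thesis using True by (simp add: L_def)
  next
    case False
    then have "odd (count_list l a)" using flip by simp
    then have "a \<in> set l" by (metis count_list_0_iff even_zero)
    then show ?thesis using False a even_part by (intro L_eqI) auto
  qed
  have "p < q" if "p \<in> set l" "q \<in> set l" "even p" "odd q" for p q
    using even_part[OF that(1,3)] odd_part[OF that(2,4)] by simp
  moreover have "even (count_list l p)" if "p \<in> set l" "p \<noteq> a" for p
    using that flip pos by blast
  moreover have "odd (count_list l a)" if "p \<in> set l" "even p" for p
    using flip even_part[OF that] pos[OF that(1)] by simp
  ultimately show "l \<in> V_eo n"
    using part a by (auto simp: V_eo_def P_eo_def La)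
qed

section \<open>Conjugation exchanges the two residue classes\<close>

lemma V_eo_conjugate:
  assumes "l \<in> V_eo n"
  shows "conjugate l \<in> V_eo n" and "[L l + L (conjugate l) = n] (mod 4)"
proof -
  let ?a = "L l" and ?b = "col_len l (L l)"
  have part: "is_partition l" and sum: "sum_list l = n"
    using assms by (auto simp: V_eo_def P_eo_def partitions_def)
  note transpose = block_profile_transpose[OF V_eo_imp_block_profile[OF assms]
      less_col_len_iff_less_row_len[OF part]]
  have conj: "conjugate l \<in> partitions n" "block_profile (col_len (conjugate l)) ?b"
    using part sum transpose(1)
    by (simp_all add: partitions_def is_partition_conjugate sum_list_conjugate col_len_conjugate)
  show "conjugate l \<in> V_eo n" using block_profile_imp_V_eo(1)[OF conj] .
  have "n = (\<Sum>i<length l. row_len l i)"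
    using sum by (simp add: sum_list_sum_nth atLeast0LessThan row_len_def)
  also have "\<dots> = (\<Sum>i<?b + 2 * length l + 1. row_len l i)"
    by (rule sum.mono_neutral_left) (auto simp: row_len_def)
  also have "[\<dots> = ?b + ?a] (mod 4)"
    using sum_block_profile[OF transpose(1)] transpose(2) by metis
  finally show "[?a + L (conjugate l) = n] (mod 4)"
    using block_profile_imp_V_eo(2)[OF conj] by (simp add: cong_sym add.commute)
qed

lemma conjugate_V_eo_mod:
  assumes "l \<in> V_eo_mod n m"
  shows "conjugate l \<in> V_eo_mod n (int n - m)"
proof -
  have l: "l \<in> V_eo n" and m: "[int (L l) = m] (mod 4)"
    using assms by (auto simp: V_eo_mod_def)
  have "[int (L l) + int (L (conjugate l)) = int n] (mod 4)"
    using V_eo_conjugate(2)[OF l] cong_int_iff by (metis of_nat_add of_nat_numeral)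
  from cong_diff[OF this m] have "[int (L (conjugate l)) = int n - m] (mod 4)"
    by simp
  then show ?thesis using V_eo_conjugate(1)[OF l] by (simp add: V_eo_mod_def)
qed

lemma V_eo_mod_cong: "[m = m'] (mod 4) \<Longrightarrow> V_eo_mod n m = V_eo_mod n m'"
  by (simp add: V_eo_mod_def cong_def)

lemma bij_betw_conjugate_V_eo_mod:
  "bij_betw conjugate (V_eo_mod n m) (V_eo_mod n (int n - m))"
proof (rule bij_betw_byWitness[where f' = conjugate])
  have part: "is_partition l" if "l \<in> V_eo_mod n m" for l m
    using that by (auto simp: V_eo_mod_def V_eo_def P_eo_def partitions_def)
  show "\<forall>l\<in>V_eo_mod n m. conjugate (conjugate l) = l"
    and "\<forall>l\<in>V_eo_mod n (int n - m). conjugate (conjugate l) = l"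
    using part conjugate_conjugate by blast+
  show "conjugate ` V_eo_mod n m \<subseteq> V_eo_mod n (int n - m)"
    using conjugate_V_eo_mod by blast
  show "conjugate ` V_eo_mod n (int n - m) \<subseteq> V_eo_mod n m"
    using conjugate_V_eo_mod[of _ n "int n - m"] by auto
qed

theorem theorem3p2:
  fixes n :: nat
  assumes "[n = 2] (mod 4)"
  shows "v_eo n 0 = v_eo n 2 \<and> bij_betw conjugate (V_eo_mod n 0) (V_eo_mod n 2)"
proof -
  have "[int n - 0 = 2] (mod 4)"
    using assms cong_int_iff[of n 2 4] by simp
  then have "bij_betw conjugate (V_eo_mod n 0) (V_eo_mod n 2)"
    using bij_betw_conjugate_V_eo_mod[of n 0] V_eo_mod_cong by metis
  then show ?thesis
    by (simp add: v_eo_def bij_betw_same_card)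
qed

end
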